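(* Let $R>0$ and let $K\subset\mathbf{E}^d$ be a closed set such that $\mathrm{reach}(K)\ge R$. If $D$ is a closed ball of radius less than or equal to $R$, then $\mathrm{reach}(K\cap D)\ge R$.
   Context: $\mathbf{E}^d$ is $d$-dimensional Euclidean space, with norm $\|\cdot\|$. $B(x,r)$ denotes the open ball with center $x$ and radius $r>0$. For $A\subset\mathbf{E}^d$, $\delta_A(a)=\inf\{\|a-x\|: x\in A\}$ is the distance from $a$ to $A$. For a closed set $K\subset\mathbf{E}^d$, $\mathrm{Unp}(K)$ is the set of points $a\in\mathbf{E}^d$ for which there is a unique $x\in K$ with $\delta_K(a)=\|a-x\|$. For $a\in K$, $\mathrm{reach}(K,a)=\sup\{r>0: B(a,r)\subset\mathrm{Unp}(K)\}$ (with value $0$ if there is no such $r$), and $\mathrm{reach}(K)=\inf_{a\in K}\mathrm{reach}(K,a)\in[0,\infty]$, with the convention $\inf\emptyset=+\infty$ (so the empty set has reach $+\infty$). *)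

theory Defs
  imports "HOL-Analysis.Analysis"
begin

text \<open>
  The library sets \<^term>\<open>infdist a {} = 0\<close>, whereas the infimum of the empty set of distances is
  \<open>+\<infinity>\<close>. This makes no difference in the next definition, which asks for a point of \<open>K\<close>.
\<close>

definition Unp :: "'a::euclidean_space set \<Rightarrow> 'a set" where
  "Unp K = {a. \<exists>!x. x \<in> K \<and> infdist a K = norm (a - x)}"

text \<open>
  Values are taken in \<^typ>\<open>ennreal\<close>, i.e. in \<open>[0, \<infinity>]\<close>, where the supremum of the empty set
  is \<open>0\<close> and the infimum of the empty set is \<open>\<infinity>\<close>: the conventions for \<open>reach_at K a\<close> when no
  radius is admissible and for \<open>reach {}\<close> are thereby built in.
\<close>

definition reach_at :: "'a::euclidean_space set \<Rightarrow> 'a \<Rightarrow> ennreal" where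
  "reach_at K a = (SUP r\<in>{r::real. 0 < r \<and> ball a r \<subseteq> Unp K}. ennreal r)"

definition reach :: "'a::euclidean_space set \<Rightarrow> ennreal" where
  "reach K = (INF a\<in>K. reach_at K a)"

lemma reach_at_eq_0:
  assumes "\<And>r. 0 < r \<Longrightarrow> \<not> ball a r \<subseteq> Unp K"
  shows "reach_at K a = 0"
proof -
  have "{r::real. 0 < r \<and> ball a r \<subseteq> Unp K} = {}"
    using assms by blast
  then show ?thesis
    unfolding reach_at_def by (simp only: image_empty Sup_empty bot_ennreal)
qed

lemma reach_empty: "reach {} = \<infinity>"
  by (simp add: reach_def)

end

theory Submission
  imports Defs
begin

text \<open>
  The bridge between the reach of \<open>K\<close> and that of \<open>K \<inter> D\<close> is the spindle of two points, the
  intersection of all closed balls of radius \<open>R\<close> containing them: a ball of radius at most \<open>R\<close>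
  containing two points contains their spindle. If \<open>reach K \<ge> R\<close>, then the projection onto \<open>K\<close> of
  the midpoint of \<open>a, b \<in> K\<close> lies in the spindle of \<open>a\<close> and \<open>b\<close> and differs from both: by
  Brouwer's theorem the normal ray at a projection keeps projecting to its foot up to distance
  \<open>R\<close>, so a ball of radius \<open>R\<close> touching \<open>K\<close> there has no point of \<open>K\<close> inside.
  Conversely, such third points prevent a point at distance less than \<open>R\<close> from having two
  nearest points.
\<close>

section \<open>Spindles and the balls that contain them\<close>

definition spindle :: "real \<Rightarrow> 'a::euclidean_space \<Rightarrow> 'a \<Rightarrow> 'a set" where
  "spindle R a b = {z. \<forall>y. dist y a \<le> R \<longrightarrow> dist y b \<le> R \<longrightarrow> dist y z \<le> R}"

text \<open>For \<open>z\<close> away from \<open>c\<close>, the ball of radius \<open>R\<close>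
  containing \<open>cball c r\<close> and touching it from inside in the direction of
  \<open>z\<close> is one of the balls defining the spindle. Its center \<open>y\<close> lies
  opposite to \<open>z\<close>, so \<open>dist y z \<le> R\<close> leaves at most \<open>r\<close>
  for the distance from \<open>c\<close> to \<open>z\<close>.\<close>

lemma spindle_subset_cball:
  assumes "a \<in> cball c r" "b \<in> cball c r" "r \<le> R"
  shows "spindle R a b \<subseteq> cball c r"
proof
  fix z assume z: "z \<in> spindle R a b"
  show "z \<in> cball c r"
  proof (cases "z = c")
    case True
    then show ?thesis using assms(1) order_trans[OF zero_le_dist] by auto
  next
    case False
    define u where "u = (z - c) /\<^sub>R norm (z - c)"
    define y where "y = c - (R - r) *\<^sub>R u"
    have u: "norm u = 1" using False by (simp add: u_def)
    have yc: "dist y c = R - r" using u assms(3) by (simp add: y_def dist_norm)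
    have "dist y a \<le> R" "dist y b \<le> R"
      using dist_triangle[of y a c] dist_triangle[of y b c] yc assms by auto
    then have "dist y z \<le> R" using z by (auto simp: spindle_def)
    moreover have "z - c = norm (z - c) *\<^sub>R u" using False by (simp add: u_def)
    then have zy: "z - y = (norm (z - c) + (R - r)) *\<^sub>R u"
      unfolding y_def scaleR_add_left by (metis add.commute diff_diff_eq2 add_diff_eq)
    have "norm (z - y) = norm (z - c) + (R - r)"
      unfolding zy using u assms(3) by simp
    ultimately show ?thesis by (simp add: dist_norm norm_minus_commute)
  qed
qed

text \<open>If \<open>z\<close> were on the sphere, the ball of radius \<open>R\<close> touching
  \<open>cball c r\<close> from inside at \<open>z\<close> would meet the sphere only there, because
  \<open>r < R\<close>. Then \<open>a\<close> and \<open>b\<close> are strictly inside the larger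
  ball, so its center can move away from \<open>z\<close> by the slack \<open>\<epsilon>\<close>:
  both points stay within \<open>R\<close>, but \<open>z\<close> does not.\<close>

lemma spindle_minus_endpoints_subset_ball:
  assumes "a \<in> cball c r" "b \<in> cball c r" "r < R"
  shows "spindle R a b - {a, b} \<subseteq> ball c r"
proof
  fix z assume "z \<in> spindle R a b - {a, b}"
  then have z: "z \<in> spindle R a b" "z \<noteq> a" "z \<noteq> b" by auto
  have zc: "dist c z \<le> r" using spindle_subset_cball[of a c r b R] assms z by auto
  show "z \<in> ball c r"
  proof (rule ccontr)
    assume "z \<notin> ball c r"
    then have nz: "norm (z - c) = r" using zc by (simp add: dist_norm norm_minus_commute)
    have r: "r > 0"
    proof (rule ccontr)
      assume "\<not> r > 0"
      moreover have "0 < dist a z" using z(2) by simp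
      ultimately show False using dist_triangle3[of a z c] assms(1) zc
        unfolding mem_cball by linarith
    qed
    define u where "u = (z - c) /\<^sub>R r"
    have u: "norm u = 1" using r nz by (simp add: u_def)
    define y where "y = c - (R - r) *\<^sub>R u"
    \<comment> \<open>Otherwise the triangle inequality through \<open>c\<close> is an equality, so
      \<open>e - c\<close> has length \<open>r\<close> and the direction of \<open>u\<close>, which
      gives \<open>e = z\<close>.\<close>
    have lt: "dist y e < R" if e: "dist c e \<le> r" "e \<noteq> z" for e
    proof (rule ccontr)
      assume "\<not> dist y e < R"
      then have ge: "norm ((e - c) + (R - r) *\<^sub>R u) \<ge> R"
        by (simp add: y_def dist_norm norm_minus_commute algebra_simps)
      have ec: "norm (e - c) \<le> r" using e(1) by (simp add: dist_norm norm_minus_commute)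
      have n2: "norm ((R - r) *\<^sub>R u) = R - r" using u assms(3) by simp
      have le: "norm ((e - c) + (R - r) *\<^sub>R u) \<le> norm (e - c) + norm ((R - r) *\<^sub>R u)"
        by (rule norm_triangle_ineq)
      have er: "norm (e - c) = r" using ge le n2 ec by linarith
      have "norm ((e - c) + (R - r) *\<^sub>R u) = norm (e - c) + norm ((R - r) *\<^sub>R u)"
        using ge le n2 ec by linarith
      then have "norm (e - c) *\<^sub>R ((R - r) *\<^sub>R u) = norm ((R - r) *\<^sub>R u) *\<^sub>R (e - c)"
        by (simp only: norm_triangle_eq)
      then have "r *\<^sub>R ((R - r) *\<^sub>R u) = (R - r) *\<^sub>R (e - c)"
        by (simp only: n2 er)
      moreover have "r *\<^sub>R u = z - c" using r by (simp add: u_def)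
      ultimately have "(R - r) *\<^sub>R (z - c) = (R - r) *\<^sub>R (e - c)"
        by (metis scaleR_left_commute)
      then show False using assms(3) e(2) by simp
    qed
    define \<epsilon> where "\<epsilon> = R - max (dist y a) (dist y b)"
    have \<epsilon>: "\<epsilon> > 0" using lt[of a] lt[of b] assms z by (auto simp: \<epsilon>_def)
    define y' where "y' = y - \<epsilon> *\<^sub>R u"
    have yy: "dist y' y = \<epsilon>" using \<epsilon> u by (simp add: y'_def dist_norm)
    have "dist y' a \<le> R" "dist y' b \<le> R"
      using dist_triangle[of y' a y] dist_triangle[of y' b y] yy by (auto simp: \<epsilon>_def)
    then have "dist y' z \<le> R" using z(1) by (auto simp: spindle_def)
    moreover have zy: "z - y' = (R + \<epsilon>) *\<^sub>R u"
      using r by (simp add: y'_def y_def u_def algebra_simps)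
    have "norm (z - y') = R + \<epsilon>" unfolding zy using u \<epsilon> r assms(3) by simp
    ultimately show False using \<epsilon> by (simp add: dist_norm norm_minus_commute)
  qed
qed

section \<open>Reach bounds as unique nearest points in an open tube, and the third-point
  criterion\<close>

lemma reach_ge_iff:
  assumes "K \<noteq> {}" "R > 0"
  shows "ennreal R \<le> reach K \<longleftrightarrow> {x. infdist x K < R} \<subseteq> Unp K"
proof
  assume reach: "ennreal R \<le> reach K"
  show "{x. infdist x K < R} \<subseteq> Unp K"
  proof
    fix x assume "x \<in> {x. infdist x K < R}"
    then have "(INF a\<in>K. dist x a) < R" using assms by (simp add: infdist_notempty)
    then obtain a where a: "a \<in> K" "dist x a < R"
      using assms by (subst (asm) cINF_less_iff) auto
    \<comment> \<open>Strictness gives an admissible radius \<open>s\<close> in the supremum that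
      already exceeds \<open>dist x a\<close>.\<close>
    have "ennreal (dist x a) < ennreal R" using a assms by (simp add: ennreal_lessI)
    also have "\<dots> \<le> reach_at K a"
      using reach a(1) unfolding reach_def by (simp add: le_INF_iff)
    finally obtain s where s: "s > 0" "ball a s \<subseteq> Unp K" "ennreal (dist x a) < ennreal s"
      unfolding reach_at_def less_SUP_iff by auto
    then have "x \<in> ball a s" by (simp add: ennreal_less_iff dist_commute)
    then show "x \<in> Unp K" using s by auto
  qed
next
  assume sub: "{x. infdist x K < R} \<subseteq> Unp K"
  show "ennreal R \<le> reach K"
    unfolding reach_def
  proof (rule INF_greatest)
    fix a assume "a \<in> K"
    then have "infdist x K < R" if "dist a x < R" for x
      using infdist_le[of a K x] that by (simp add: dist_commute)
    then have "ball a R \<subseteq> Unp K" using sub by auto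
    then show "ennreal R \<le> reach_at K a"
      unfolding reach_at_def using assms by (intro SUP_upper) auto
  qed
qed

lemma Unp_iff_inj:
  assumes "closed K" "K \<noteq> {}"
  shows "x \<in> Unp K \<longleftrightarrow>
    (\<forall>a\<in>K. \<forall>b\<in>K. dist x a = infdist x K \<longrightarrow> dist x b = infdist x K \<longrightarrow> a = b)"
proof -
  obtain z where "z \<in> K" "dist x z = infdist x K"
    using infdist_attains_inf[OF assms, of x] by metis
  then show ?thesis unfolding Unp_def dist_norm mem_Collect_eq by metis
qed

lemma spindle_imp_reach_ge:
  fixes L :: "'a::euclidean_space set"
  assumes "closed L" "R > 0"
    and spindle: "\<And>a b. a \<in> L \<Longrightarrow> b \<in> L \<Longrightarrow> a \<noteq> b \<Longrightarrow> dist a b < 2 * R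
      \<Longrightarrow> \<exists>z\<in>L. z \<in> spindle R a b - {a, b}"
  shows "ennreal R \<le> reach L"
proof (cases "L = {}")
  case True
  then show ?thesis by (simp add: reach_empty)
next
  case False
  have "x \<in> Unp L" if x: "infdist x L < R" for x
    unfolding Unp_iff_inj[OF assms(1) False]
  proof (intro ballI impI, rule ccontr)
    fix a b
    assume ab: "a \<in> L" "b \<in> L" "dist x a = infdist x L" "dist x b = infdist x L" "a \<noteq> b"
    have "dist a b \<le> dist x a + dist x b" by (metis dist_commute dist_triangle)
    then obtain z where z: "z \<in> L" "z \<in> spindle R a b - {a, b}"
      using spindle[of a b] ab x by fastforce
    \<comment> \<open>Both nearest points lie on the sphere about \<open>x\<close> of radius
      \<open>infdist x L < R\<close>, so the third point is strictly inside it.\<close>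
    then have "dist x z < infdist x L"
      using spindle_minus_endpoints_subset_ball[of a x "infdist x L" b R] ab x by auto
    then show False using infdist_le[OF z(1), of x] by simp
  qed
  then show ?thesis using reach_ge_iff[OF False assms(2)] by auto
qed

section \<open>Nearest-point projection and normal rays\<close>

definition proj :: "'a::euclidean_space set \<Rightarrow> 'a \<Rightarrow> 'a" where
  "proj K x = (SOME z. z \<in> K \<and> dist x z = infdist x K)"

lemma proj:
  assumes "closed K" "K \<noteq> {}"
  shows proj_in: "proj K x \<in> K" and dist_proj: "dist x (proj K x) = infdist x K"
  using someI_ex[of "\<lambda>z. z \<in> K \<and> dist x z = infdist x K"] infdist_attains_inf[OF assms, of x]
  unfolding proj_def by metis+

lemma proj_eqI:
  assumes "closed K" "x \<in> Unp K" "z \<in> K" "dist x z = infdist x K"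
  shows "proj K x = z"
  using assms Unp_iff_inj[of K x] proj[of K x] by blast

text \<open>A map with closed graph into a compact set is continuous. By uniqueness, the graph over
  \<open>S\<close> is cut out of \<open>S \<times> K\<close> by the closed condition
  \<open>dist = infdist\<close>; the values lie in \<open>T\<close>, which is \<open>S\<close>
  thickened by a bound \<open>e\<close> on the distances to \<open>K\<close>.\<close>

lemma continuous_on_proj:
  assumes "closed K" "K \<noteq> {}" "compact S" "S \<subseteq> Unp K"
  shows "continuous_on S (proj K)"
proof -
  obtain e where e: "\<And>x. x \<in> S \<Longrightarrow> infdist x K \<le> e"
  proof -
    have "compact ((\<lambda>x. infdist x K) ` S)"
      by (intro compact_continuous_image continuous_intros assms)
    from compact_imp_bounded[OF this] obtain e where "\<And>x. x \<in> S \<Longrightarrow> norm (infdist x K) \<le> e"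
      unfolding bounded_iff by auto
    then show ?thesis by (metis that abs_le_D1 real_norm_def)
  qed
  define T where "T = (\<Union>x\<in>S. \<Union>y\<in>cball 0 e. {x + y})"
  have "compact T" unfolding T_def by (rule compact_sums'[OF assms(3) compact_cball])
  moreover have "proj K ` S \<subseteq> T"
  proof
    fix w assume "w \<in> proj K ` S"
    then obtain x where x: "x \<in> S" "w = proj K x" by auto
    have "w - x \<in> cball 0 e"
      using e[OF x(1)] dist_proj[OF assms(1,2), of x] x
      by (simp add: dist_norm norm_minus_commute)
    then show "w \<in> T" unfolding T_def by (intro UN_I[OF x(1)] UN_I[of "w - x"]) auto
  qed
  moreover have "closed ((\<lambda>x. Pair x (proj K x)) ` S)"
  proof -
    have "(\<lambda>x. Pair x (proj K x)) ` S
      = (S \<times> K) \<inter> {p. dist (fst p) (snd p) = infdist (fst p) K}"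
      using proj[OF assms(1,2)] assms(4) proj_eqI[OF assms(1)]
      by (auto simp: image_iff)
    moreover have "closed {p. dist (fst p) (snd p) = infdist (fst p :: 'a) K}"
      by (intro closed_Collect_eq continuous_intros)
    ultimately show ?thesis
      using assms by (simp add: closed_Int closed_Times compact_imp_closed)
  qed
  ultimately show ?thesis
    by (intro continuous_from_closed_graph[of T]) auto
qed

lemma exists_farther_point_same_proj:
  fixes K :: "'a::euclidean_space set"
  assumes "closed K" "z \<in> K" "{x. infdist x K < R} \<subseteq> Unp K"
    and "norm v = 1" "0 < t" "t < R" "infdist (z + t *\<^sub>R v) K = t"
  shows "\<exists>s. t < s \<and> s \<le> R \<and> infdist (z + s *\<^sub>R v) K = s"
proof -
  have ne: "K \<noteq> {}" using assms by auto
  define x where "x = z + t *\<^sub>R v"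
  \<comment> \<open>Half the gap to \<open>R\<close> keeps \<open>cball x \<epsilon>\<close> inside
    the tube, where \<open>proj K\<close> is continuous.\<close>
  define \<epsilon> where "\<epsilon> = (R - t) / 2"
  have \<epsilon>: "\<epsilon> > 0" "t + \<epsilon> < R" using assms by (auto simp: \<epsilon>_def field_simps)
  have near: "infdist y K \<le> t + \<epsilon>" if "y \<in> cball x \<epsilon>" for y
    using infdist_triangle[of y K x] that assms by (auto simp: x_def dist_commute)
  have "cball x \<epsilon> \<subseteq> Unp K" using near \<epsilon> assms(3) by fastforce
  then have cont: "continuous_on (cball x \<epsilon>) (proj K)"
    by (intro continuous_on_proj assms ne compact_cball)
  have xK: "x - k \<noteq> 0" if "k \<in> K" for k
    using infdist_le[OF that, of x] assms by (auto simp: x_def)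
  define u where "u y = (x - proj K y) /\<^sub>R norm (x - proj K y)" for y
  have u: "norm (u y) = 1" for y
    using xK[OF proj_in[OF assms(1) ne]] by (simp add: u_def)
  \<comment> \<open>A fixed point lies beyond \<open>x\<close> on the ray through \<open>x\<close> from its own projection.\<close>
  obtain y where y: "y \<in> cball x \<epsilon>" "x + \<epsilon> *\<^sub>R u y = y"
  proof (rule brouwer_ball[OF \<epsilon>(1)])
    show "continuous_on (cball x \<epsilon>) (\<lambda>y. x + \<epsilon> *\<^sub>R u y)"
      unfolding u_def using xK[OF proj_in[OF assms(1) ne]]
      by (intro continuous_intros cont) auto
    show "(\<lambda>y. x + \<epsilon> *\<^sub>R u y) \<in> cball x \<epsilon> \<rightarrow> cball x \<epsilon>"
      using u \<epsilon> by (auto simp: dist_norm)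
  qed
  define p where "p = proj K y"
  have p: "p \<in> K" "dist y p = infdist y K"
    using proj[OF assms(1) ne] by (auto simp: p_def)
  have nx: "x - p = norm (x - p) *\<^sub>R u y" using xK[OF p(1)] by (simp add: u_def p_def)
  have "y - p = (norm (x - p) + \<epsilon>) *\<^sub>R u y"
  proof -
    have "y - p = (x - p) + \<epsilon> *\<^sub>R u y" using y(2) by (simp add: algebra_simps)
    also have "\<dots> = norm (x - p) *\<^sub>R u y + \<epsilon> *\<^sub>R u y" using nx by simp
    finally show ?thesis by (simp add: scaleR_add_left)
  qed
  then have yp: "dist y p = dist x p + \<epsilon>"
    using u[of y] \<epsilon> by (simp add: dist_norm)
  \<comment> \<open>As \<open>y\<close> is \<open>\<epsilon>\<close> beyond \<open>x\<close> on the
    ray from \<open>p\<close>, and at most \<open>t + \<epsilon>\<close> from \<open>K\<close>,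
    \<open>p\<close> is within \<open>t\<close> of \<open>x\<close>. Uniqueness at \<open>x\<close>
    then identifies \<open>p\<close> with \<open>z\<close>, so \<open>y\<close> lies on the original
    ray.\<close>
  have "dist x p = infdist x K"
    using near[OF y(1)] yp p infdist_le[OF p(1), of x] assms by (simp add: x_def)
  moreover have "x \<in> Unp K" "dist x z = infdist x K"
    using assms by (auto simp: x_def dist_norm)
  ultimately have pz: "p = z"
    using Unp_iff_inj[OF assms(1) ne, of x] p(1) assms(2) by blast
  have "x - p = t *\<^sub>R v" by (simp add: pz x_def)
  then have "u y = v" using assms by (simp add: u_def flip: p_def)
  then have yv: "y = z + (t + \<epsilon>) *\<^sub>R v" using y(2) by (simp add: x_def algebra_simps)
  have "infdist y K = t + \<epsilon>"
    using yp p pz assms by (simp add: x_def dist_norm)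
  then show ?thesis using \<epsilon> yv by (intro exI[of _ "t + \<epsilon>"]) auto
qed

text \<open>The good parameters in \<open>{t..R}\<close> form a compact set; its largest element
  must be \<open>R\<close>, since any smaller one could be exceeded.\<close>

lemma infdist_along_normal:
  fixes K :: "'a::euclidean_space set"
  assumes "closed K" "z \<in> K" "{x. infdist x K < R} \<subseteq> Unp K"
    and "norm v = 1" "0 < t" "t < R" "infdist (z + t *\<^sub>R v) K = t"
  shows "infdist (z + R *\<^sub>R v) K = R"
proof -
  define T where "T = {t..R} \<inter> {s. infdist (z + s *\<^sub>R v) K = s}"
  have "compact T" unfolding T_def
    by (intro compact_Int_closed compact_Icc closed_Collect_eq continuous_intros)
  moreover have "t \<in> T" using assms by (auto simp: T_def)
  ultimately obtain s where s: "s \<in> T" "\<And>s'. s' \<in> T \<Longrightarrow> s' \<le> s"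
    using compact_attains_sup[of T] by blast
  have "s = R"
  proof (rule ccontr)
    assume "s \<noteq> R"
    then have "0 < s" "s < R" "infdist (z + s *\<^sub>R v) K = s" using s(1) assms by (auto simp: T_def)
    from exists_farther_point_same_proj[OF assms(1-4) this] s obtain s' where
      "s < s'" "s' \<in> T" by (auto simp: T_def)
    then show False using s(2) by fastforce
  qed
  then show ?thesis using s by (auto simp: T_def)
qed

section \<open>The median-length formula and third points near midpoints\<close>

lemma dist_midpoint_power2:
  fixes y a b :: "'a::euclidean_space"
  shows "(dist y (midpoint a b))\<^sup>2 = ((dist y a)\<^sup>2 + (dist y b)\<^sup>2) / 2 - (dist a b / 2)\<^sup>2"
  unfolding dist_norm midpoint_def power_divide power2_norm_eq_inner
  by (simp add: algebra_simps inner_commute field_simps)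

lemma reach_ge_imp_spindle:
  fixes K :: "'a::euclidean_space set"
  assumes "closed K" "R > 0" "ennreal R \<le> reach K"
    and ab: "a \<in> K" "b \<in> K" "a \<noteq> b" "dist a b < 2 * R"
  shows "\<exists>z\<in>K. z \<in> spindle R a b - {a, b}"
proof -
  have ne: "K \<noteq> {}" using ab by auto
  have unp: "{x. infdist x K < R} \<subseteq> Unp K" using assms reach_ge_iff[OF ne] by auto
  define l where "l = dist a b / 2"
  define m where "m = midpoint a b"
  define d where "d = infdist m K"
  define z where "z = proj K m"
  have l: "0 < l" "l < R" using ab by (auto simp: l_def)
  have ml: "dist m a = l" "dist m b = l" by (auto simp: m_def l_def dist_midpoint)
  have z: "z \<in> K" "dist m z = d" using proj[OF assms(1) ne] by (auto simp: z_def d_def)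
  have d: "0 \<le> d" "d \<le> l" using infdist_le[OF ab(1), of m] ml by (auto simp: d_def infdist_nonneg)
  \<comment> \<open>By the median formula, centers within \<open>R\<close> of \<open>a\<close> and
    \<open>b\<close> have squared distance at most \<open>R\<^sup>2 - l\<^sup>2\<close> from
    \<open>m\<close>. Once this is at most \<open>(R - d)\<^sup>2\<close>, they are within
    \<open>R\<close> of \<open>z\<close>. For \<open>d > 0\<close> the bound comes from
    \<open>w\<close>, whose distance to \<open>K\<close>, hence to \<open>a\<close> and
    \<open>b\<close>, is at least \<open>R\<close>.\<close>
  have key: "(R - d)\<^sup>2 \<ge> R\<^sup>2 - l\<^sup>2"
  proof (cases "d = 0")
    case False
    define v where "v = (m - z) /\<^sub>R d"
    define w where "w = z + R *\<^sub>R v"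
    have v: "norm v = 1" using z(2) d False by (simp add: v_def dist_norm)
    have mz: "m = z + d *\<^sub>R v" using False by (simp add: v_def)
    have "infdist (z + d *\<^sub>R v) K = d" using mz d_def by simp
    then have "infdist w K = R"
      unfolding w_def using infdist_along_normal[OF assms(1) z(1) unp v, of d] d l False
      by simp
    then have "R \<le> dist w a" "R \<le> dist w b" using infdist_le[of _ K w] ab by auto
    then have "R\<^sup>2 \<le> (dist w a)\<^sup>2" "R\<^sup>2 \<le> (dist w b)\<^sup>2"
      using assms(2) by (auto intro!: power_mono)
    then have "R\<^sup>2 - l\<^sup>2 \<le> (dist w m)\<^sup>2"
      using dist_midpoint_power2[of w a b] by (simp add: m_def l_def)
    also have "w - m = (R - d) *\<^sub>R v" using mz by (simp add: w_def algebra_simps)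
    then have "dist w m = R - d" using v d l by (simp add: dist_norm)
    finally show ?thesis .
  qed simp
  have "z \<in> spindle R a b"
    unfolding spindle_def
  proof (intro CollectI allI impI)
    fix y assume "dist y a \<le> R" "dist y b \<le> R"
    then have "(dist y a)\<^sup>2 \<le> R\<^sup>2" "(dist y b)\<^sup>2 \<le> R\<^sup>2"
      by (auto intro!: power_mono)
    then have "(dist y m)\<^sup>2 \<le> R\<^sup>2 - l\<^sup>2"
      using dist_midpoint_power2[of y a b] by (simp add: m_def l_def)
    then have "(dist y m)\<^sup>2 \<le> (R - d)\<^sup>2" using key by linarith
    then have "dist y m \<le> R - d" by (rule power2_le_imp_le) (use d l in simp)
    then show "dist y z \<le> R" using dist_triangle[of y z m] z(2) by linarith
  qed
  \<comment> \<open>For \<open>d = l\<close> the bound \<open>key\<close> would force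
    \<open>R \<le> l\<close>; and \<open>a\<close>, \<open>b\<close> are at distance exactly
    \<open>l\<close> from \<open>m\<close>.\<close>
  moreover have "d \<noteq> l"
  proof
    assume "d = l"
    then have "l * R \<le> l * l" using key by (simp add: power2_eq_square algebra_simps)
    then show False using l by simp
  qed
  then have "z \<noteq> a" "z \<noteq> b" using z(2) ml by auto
  ultimately show ?thesis using z(1) by blast
qed

theorem theorem3p10:
  fixes K :: "'a::euclidean_space set" and c :: 'a and R r :: real
  assumes "R > 0"
    and "closed K"
    and "reach K \<ge> ennreal R"
    and "0 < r" and "r \<le> R"
  shows "reach (K \<inter> cball c r) \<ge> ennreal R"
proof (rule spindle_imp_reach_ge)
  show "closed (K \<inter> cball c r)" using assms(2) by auto
  fix a b
  assume ab: "a \<in> K \<inter> cball c r" "b \<in> K \<inter> cball c r" "a \<noteq> b" "dist a b < 2 * R"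
  then obtain z where "z \<in> K" "z \<in> spindle R a b - {a, b}"
    using reach_ge_imp_spindle[OF assms(2,1,3)] by blast
  \<comment> \<open>The third point found in \<open>K\<close> stays in the ball, because the whole
    spindle of \<open>a\<close> and \<open>b\<close> does.\<close>
  then show "\<exists>z\<in>K \<inter> cball c r. z \<in> spindle R a b - {a, b}"
    using spindle_subset_cball[of a c r b R] ab assms(5) by blast
qed (fact assms(1))

end
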